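(* Let $b$ be a known real number with $b \ge 1$, and let $X$ have the Poisson distribution with mean $b+\theta$, where $\theta\in[0,\infty)$ is unknown. Under squared error loss for estimating $p=p_\theta(n)=b^n/(b+\theta)^n$ upon observing $X=n$, the maximum likelihood estimator $$p_{\hat\theta}(n)=\frac{b^n}{(b\vee n)^n},\qquad n=0,1,2,\dots,$$ is inadmissible.
   Context: Setting: $X=B+S$ where $B$ and $S$ are independent Poisson random variables with means $b$ (known) and $\theta\ge 0$ (unknown) respectively, so $X$ is Poisson with mean $b+\theta$. Write $f_\mu(n)=e^{-\mu}\mu^n/n!$ for the Poisson probability mass function with mean $\mu$, and $x\vee y=\max(x,y)$. The quantity to be estimated given $X=n$ is $p_\theta(n)=P_\theta[S=0\mid X=n]=b^n/(b+\theta)^n$ (equal to $1$ when $n=0$); note it depends on both $\theta$ and $n$. The function $p_{\hat\theta}(n)$ is obtained by substituting the maximum likelihood estimator $\hat\theta=\max(0,n-b)$ for $\theta$; for $n=0$ it equals $1$. An estimator $\tilde p$ of $p$ is a function $\tilde p:\{0,1,2,\dots\}\to[0,1]$, used as $\tilde p(X)$. Its risk under squared error loss is $$R(\tilde p,\theta)=E_\theta[(\tilde p-p)^2]=\sum_{n=0}^\infty\Big[\tilde p(n)-\frac{b^n}{(b+\theta)^n}\Big]^2 f_{b+\theta}(n),\qquad \theta\ge 0.$$ An estimator $\tilde p$ is inadmissible if there is an estimator $\tilde p'$ with $R(\tilde p',\theta)\le R(\tilde p,\theta)$ for all $\theta\ge 0$, with strict inequality for some $\theta\ge 0$; otherwise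 it is admissible. *)

theory Defs
  imports "HOL-Probability.Probability"
begin

text \<open>
  The mean of the background \<open>B\<close> is \<open>b\<close>, the mean of the signal \<open>S\<close> is \<open>\<theta>\<close>, and the
  observation is \<open>X = B + S\<close>.  The library's \<^const>\<open>poisson_pmf\<close> is specified only for positive
  rates, so the degenerate signal distribution at \<open>\<theta> = 0\<close> is given separately; \<open>X\<close> itself always
  has a positive rate because \<open>b > 0\<close>.
\<close>

definition signal_pmf :: "real \<Rightarrow> nat pmf" where
  "signal_pmf \<theta> = (if \<theta> = 0 then return_pmf 0 else poisson_pmf \<theta>)"

definition no_signal_prob :: "real \<Rightarrow> real \<Rightarrow> nat \<Rightarrow> real" where
  "no_signal_prob b \<theta> n = b ^ n / (b + \<theta>) ^ n"

definition mle_signal :: "real \<Rightarrow> nat \<Rightarrow> real" where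
  "mle_signal b n = max 0 (real n - b)"

definition mle_no_signal_prob :: "real \<Rightarrow> nat \<Rightarrow> real" where
  "mle_no_signal_prob b n = no_signal_prob b (mle_signal b n) n"

definition is_estimator :: "(nat \<Rightarrow> real) \<Rightarrow> bool" where
  "is_estimator e \<longleftrightarrow> (\<forall>n. e n \<in> {0..1})"

definition risk :: "real \<Rightarrow> (nat \<Rightarrow> real) \<Rightarrow> real \<Rightarrow> real" where
  "risk b e \<theta> =
     measure_pmf.expectation (poisson_pmf (b + \<theta>)) (\<lambda>n. (e n - no_signal_prob b \<theta> n)\<^sup>2)"

definition inadmissible :: "real \<Rightarrow> (nat \<Rightarrow> real) \<Rightarrow> bool" where
  "inadmissible b e \<longleftrightarrow> is_estimator e \<and>
     (\<exists>e'. is_estimator e' \<and> (\<forall>\<theta>\<ge>0. risk b e' \<theta> \<le> risk b e \<theta>) \<and> (\<exists>\<theta>\<ge>0. risk b e' \<theta> < risk b e \<theta>))"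

lemma mle_no_signal_prob_eq: "mle_no_signal_prob b n = b ^ n / (max b (real n)) ^ n"
proof -
  have "b + max 0 (real n - b) = max b (real n)" by (simp add: max_def)
  then show ?thesis by (simp add: mle_no_signal_prob_def no_signal_prob_def mle_signal_def)
qed

lemma mle_signal_maximizes_likelihood:
  assumes "b > 0" "\<theta> \<ge> 0"
  shows "pmf (poisson_pmf (b + \<theta>)) n \<le> pmf (poisson_pmf (b + mle_signal b n)) n"
proof -
  define m where "m = max b (real n)"
  define \<mu> where "\<mu> = b + \<theta>"
  have m: "b + mle_signal b n = m" "m > 0" "real n \<le> m" and mu: "\<mu> > 0" "b \<le> \<mu>"
    using assms by (auto simp: mle_signal_def m_def \<mu>_def max_def)
  have "\<mu> / m \<le> exp (\<mu> / m - 1)" using exp_ge_add_one_self[of "\<mu> / m - 1"] by simp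
  then have "(\<mu> / m) ^ n \<le> exp (\<mu> / m - 1) ^ n"
    using m mu by (intro power_mono) auto
  also have "\<dots> = exp (real n * (\<mu> / m - 1))" by (rule exp_of_nat_mult[symmetric])
  also have "real n * (\<mu> / m - 1) \<le> \<mu> - m"
  proof (cases "real n \<le> b")
    case True
    then have "m = b" by (simp add: m_def)
    then have "0 \<le> \<mu> / m - 1" using m mu by (simp add: field_simps)
    then have "real n * (\<mu> / m - 1) \<le> m * (\<mu> / m - 1)" using m by (intro mult_right_mono)
    also have "\<dots> = \<mu> - m" using m by (simp add: field_simps)
    finally show ?thesis .
  next
    case False
    then have "real n = m" by (simp add: m_def)
    then show ?thesis using m by (simp add: field_simps)
  qed
  finally have "(\<mu> / m) ^ n \<le> exp (\<mu> - m)" by simp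
  then have "\<mu> ^ n * exp (- \<mu>) \<le> m ^ n * exp (- m)"
    using m(2) by (simp add: power_divide exp_diff exp_minus field_simps)
  then have "\<mu> ^ n / fact n * exp (- \<mu>) \<le> m ^ n / fact n * exp (- m)"
    by (simp add: divide_right_mono)
  then show ?thesis using m(1,2) mu by (simp flip: \<mu>_def)
qed

lemma risk_sums:
  assumes "b > 0" "\<theta> \<ge> 0" "is_estimator e"
  shows "(\<lambda>n. (e n - b ^ n / (b + \<theta>) ^ n)\<^sup>2 * (exp (- (b + \<theta>)) * (b + \<theta>) ^ n / fact n))
           sums risk b e \<theta>"
proof -
  let ?p = "poisson_pmf (b + \<theta>)" and ?f = "\<lambda>n. (e n - no_signal_prob b \<theta> n)\<^sup>2"
  have p: "0 \<le> no_signal_prob b \<theta> n" "no_signal_prob b \<theta> n \<le> 1" for n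
    using assms by (auto simp: no_signal_prob_def intro!: power_mono divide_le_eq_1_pos[THEN iffD2])
  have "norm (?f n) \<le> 1" for n
  proof -
    have "\<bar>e n - no_signal_prob b \<theta> n\<bar> \<le> 1"
      using p[of n] assms(3) by (auto simp: is_estimator_def abs_le_iff dest!: spec[of _ n])
    then show ?thesis by (simp add: abs_square_le_1)
  qed
  then have "integrable (measure_pmf ?p) ?f"
    by (intro measure_pmf.integrable_const_bound[where B = 1]) auto
  then have "integrable (count_space UNIV) (\<lambda>n. pmf ?p n *\<^sub>R ?f n)"
    by (subst (asm) measure_pmf_eq_density, subst (asm) integrable_density) auto
  from sums_integral_count_space_nat[OF this]
  have "(\<lambda>n. pmf ?p n *\<^sub>R ?f n) sums risk b e \<theta>"
    by (simp add: risk_def measure_pmf_eq_density integral_density)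
  then show ?thesis using assms by (simp add: no_signal_prob_def mult_ac)
qed

lemma pmf_signal:
  assumes "\<theta> \<ge> 0"
  shows "pmf (signal_pmf \<theta>) n = \<theta> ^ n / fact n * exp (- \<theta>)"
  using assms by (cases n) (auto simp: signal_pmf_def pmf_return)

lemma observation_pmf:
  assumes "b > 0" "\<theta> \<ge> 0"
  shows "map_pmf (\<lambda>(B, S). B + S) (pair_pmf (poisson_pmf b) (signal_pmf \<theta>)) = poisson_pmf (b + \<theta>)"
proof (rule pmf_eqI)
  fix n :: nat
  let ?J = "pair_pmf (poisson_pmf b) (signal_pmf \<theta>)"
  have v: "(\<lambda>(B, S). B + S) -` {n} = (\<lambda>k. (k, n - k)) ` {..n}" by (auto simp: image_iff)
  have "pmf (map_pmf (\<lambda>(B, S). B + S) ?J) n = measure_pmf.prob ?J ((\<lambda>k. (k, n - k)) ` {..n})"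
    by (simp only: pmf_map v)
  also have "\<dots> = (\<Sum>k\<le>n. pmf ?J (k, n - k))"
    by (subst measure_measure_pmf_finite) (auto simp: sum.reindex inj_on_def)
  also have "\<dots> = (\<Sum>k\<le>n. real (n choose k) * b ^ k * \<theta> ^ (n - k) * (exp (- (b + \<theta>)) / fact n))"
    using assms by (intro sum.cong)
      (auto simp: pmf_pair pmf_signal binomial_fact exp_add exp_diff exp_minus field_simps)
  also have "\<dots> = (b + \<theta>) ^ n * (exp (- (b + \<theta>)) / fact n)"
    by (simp only: binomial_ring sum_distrib_right)
  also have "\<dots> = pmf (poisson_pmf (b + \<theta>)) n" using assms by simp
  finally show "pmf (map_pmf (\<lambda>(B, S). B + S) ?J) n = pmf (poisson_pmf (b + \<theta>)) n" .
qed

lemma no_signal_prob_eq_cond_prob: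
  assumes "b > 0" "\<theta> \<ge> 0"
  shows "no_signal_prob b \<theta> n =
    \<P>(x in measure_pmf (pair_pmf (poisson_pmf b) (signal_pmf \<theta>)). snd x = 0 \<bar> fst x + snd x = n)"
proof -
  let ?J = "pair_pmf (poisson_pmf b) (signal_pmf \<theta>)"
  have "{x. fst x + snd x = n} = (\<lambda>(B, S). B + S) -` {n}" by auto
  then have "measure_pmf.prob ?J {x. fst x + snd x = n} = pmf (map_pmf (\<lambda>(B, S). B + S) ?J) n"
    by (simp only: pmf_map)
  also have "\<dots> = (b + \<theta>) ^ n / fact n * exp (- (b + \<theta>))"
    using assms by (simp add: observation_pmf)
  finally have d: "measure_pmf.prob ?J {x. fst x + snd x = n} = \<dots>" .
  have "{x. snd x = 0 \<and> fst x + snd x = n} = {(n, 0)}" by auto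
  then have "measure_pmf.prob ?J {x. snd x = 0 \<and> fst x + snd x = n} = pmf ?J (n, 0)"
    by (simp add: measure_pmf_single)
  also have "\<dots> = b ^ n / fact n * exp (- (b + \<theta>))"
    using assms by (simp add: pmf_pair pmf_signal exp_diff exp_minus exp_add field_simps)
  finally show ?thesis using d
    by (simp add: cond_prob_def no_signal_prob_def)
qed

end

theory Submission
  imports Defs
begin

text \<open>
  Write \<open>a n\<close> for the maximum likelihood estimator and \<open>\<mu> = b + \<theta> \<ge> b\<close>. Changing \<open>a\<close> to
  \<open>a + t d\<close> with \<open>d\<close> finitely supported changes the risk by a finite sum: in terms of
  \<open>c n = d n b^n / n!\<close> and \<open>v = b / \<mu> \<in> (0, 1]\<close>, and up to the factor \<open>t exp (- \<mu>)\<close>, it is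

  \<open>\<Sum>n. 2 c n (a n v^(-n) - 1) + t (c n)^2 (n! / b^n) v^(-n)\<close>.

  After multiplication by \<open>v^k\<close>, where \<open>k\<close> is the largest point of the support, both parts are
  polynomials in \<open>v\<close>, and one may work on the compact interval \<open>[0, 1]\<close>, whose end points
  correspond to \<open>\<mu> = \<infinity>\<close> and \<open>\<mu> = b\<close>. If the first-order part is negative on all of \<open>[0, 1]\<close>,
  then \<open>a + t d\<close> has strictly smaller risk at every \<open>\<theta>\<close> once \<open>t > 0\<close> is small.

  Three points suffice to make the first-order part negative. Since \<open>b \<ge> 1\<close>, \<open>a 1 = 1\<close>, and
  lowering \<open>a\<close> at \<open>1\<close>, with \<open>c 1 = -1\<close>, contributes \<open>-2 (v^(k - 1) - v^k)\<close>, which is negative except at \<open>v = 0\<close> and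
  \<open>v = 1\<close>. These two exceptions are repaired by a much smaller change at two consecutive
  points \<open>m\<close> and \<open>k = m + 1\<close> with \<open>m > b\<close>, where the estimator is below \<open>1\<close>: raising \<open>a m\<close> helps
  at \<open>v = 1\<close> (there the true value is \<open>1\<close>), and lowering \<open>a k\<close> helps at \<open>v = 0\<close> (the term with the
  highest power of \<open>\<mu>\<close> dominates). Taking \<open>c k = - (1 - a m) c m\<close> keeps the harm that the latter
  does at \<open>v = 1\<close> below the gain from the former. How small is small is settled both
  times by the compactness lemma \<open>eventually_perturb_neg\<close>.
\<close>

section \<open>Small perturbations on a compact set\<close>

lemma eventually_perturb_neg:
  fixes f h :: "'a::topological_space \<Rightarrow> real"
  assumes K: "compact K" and f: "continuous_on K f" and h: "continuous_on K h"
    and nonpos: "\<And>x. x \<in> K \<Longrightarrow> f x \<le> 0"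
    and neg: "\<And>x. x \<in> K \<Longrightarrow> f x = 0 \<Longrightarrow> h x < 0"
  shows "\<forall>\<^sub>F \<epsilon> in at_right 0. \<forall>x\<in>K. f x + \<epsilon> * h x < 0"
proof -
  \<comment> \<open>Off the set \<open>L\<close> every \<open>\<epsilon> > 0\<close> works; on \<open>L\<close>, \<open>f\<close> is bounded
    away from \<open>0\<close> and \<open>h\<close> is bounded above.\<close>
  define L where "L = K \<inter> h -` {0..}"
  have bad: "x \<in> L" if "x \<in> K" "\<epsilon> > 0" "\<not> f x + \<epsilon> * h x < 0" for x \<epsilon>
    using that nonpos[of x] mult_pos_neg[of \<epsilon> "h x"] by (force simp: L_def)
  have L: "compact L"
  proof -
    obtain C where "closed C" "C \<inter> K = h -` {0..} \<inter> K"
      using h unfolding continuous_on_closed_invariant by (meson closed_atLeast)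
    then have "L = K \<inter> C" by (auto simp: L_def)
    then show ?thesis using K \<open>closed C\<close> by (simp add: compact_Int_closed)
  qed
  show ?thesis
  proof (cases "L = {}")
    case True
    then show ?thesis using bad
      by (auto intro!: eventually_at_right_less[THEN eventually_mono])
  next
    case False
    have "L \<subseteq> K" by (auto simp: L_def)
    then obtain x0 y0 where x0: "x0 \<in> L" "\<And>x. x \<in> L \<Longrightarrow> f x \<le> f x0"
      and y0: "\<And>x. x \<in> L \<Longrightarrow> h x \<le> h y0"
      using continuous_attains_sup[OF L False continuous_on_subset[OF f]]
        continuous_attains_sup[OF L False continuous_on_subset[OF h]] by blast
    have "f x0 < 0" using x0(1) nonpos[of x0] neg[of x0] by (force simp: L_def)
    moreover have "((\<lambda>\<epsilon>. f x0 + \<epsilon> * h y0) \<longlongrightarrow> f x0 + 0 * h y0) (at_right 0)"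
      by (intro tendsto_intros)
    ultimately have "\<forall>\<^sub>F \<epsilon> in at_right 0. f x0 + \<epsilon> * h y0 < 0"
      by (auto dest: order_tendstoD)
    then show ?thesis using eventually_at_right_less[of 0]
    proof eventually_elim
      case (elim \<epsilon>)
      have "f x + \<epsilon> * h x < 0" if "x \<in> L" for x
        using elim x0(2)[OF that] mult_left_mono[OF y0[OF that], of \<epsilon>] by linarith
      then show ?case using bad[of _ \<epsilon>] elim by blast
    qed
  qed
qed

section \<open>Differences of risks\<close>

lemma weighted_square_diff:
  fixes M :: real
  assumes "M \<noteq> 0"
  shows "(x - B / M)\<^sup>2 * (E * M / F) - (y - B / M)\<^sup>2 * (E * M / F) =
    E * (((x\<^sup>2 - y\<^sup>2) * M - 2 * (x - y) * B) / F)"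
proof -
  define q where "q = B / M"
  then have B: "B = q * M" using assms by simp
  have diff: "(x - q)\<^sup>2 - (y - q)\<^sup>2 = (x\<^sup>2 - y\<^sup>2) - 2 * (x - y) * q"
    by (simp add: power2_diff algebra_simps)
  have "(x - B / M)\<^sup>2 * (E * M / F) - (y - B / M)\<^sup>2 * (E * M / F) =
      ((x - q)\<^sup>2 - (y - q)\<^sup>2) * (E * M / F)"
    unfolding q_def by (rule left_diff_distrib[symmetric])
  also have "\<dots> = E * (((x\<^sup>2 - y\<^sup>2) * M - 2 * (x - y) * B) / F)"
    unfolding diff B by (simp add: algebra_simps diff_divide_distrib add_divide_distrib)
  finally show ?thesis .
qed

text \<open>
  The risk is a quadratic functional of the estimator, and the square of the estimated quantity
  cancels in a difference of risks.
\<close>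

lemma risk_diff:
  assumes "b > 0" "\<theta> \<ge> 0" "is_estimator e" "is_estimator e'" "finite N"
    and eq: "\<And>n. n \<notin> N \<Longrightarrow> e' n = e n"
  shows "risk b e' \<theta> - risk b e \<theta> =
    exp (- (b + \<theta>)) * (\<Sum>n\<in>N. (((e' n)\<^sup>2 - (e n)\<^sup>2) * (b + \<theta>) ^ n - 2 * (e' n - e n) * b ^ n) / fact n)"
proof -
  define g where "g n = exp (- (b + \<theta>)) *
    ((((e' n)\<^sup>2 - (e n)\<^sup>2) * (b + \<theta>) ^ n - 2 * (e' n - e n) * b ^ n) / fact n)" for n
  have g: "(e' n - b ^ n / (b + \<theta>) ^ n)\<^sup>2 * (exp (- (b + \<theta>)) * (b + \<theta>) ^ n / fact n)
      - (e n - b ^ n / (b + \<theta>) ^ n)\<^sup>2 * (exp (- (b + \<theta>)) * (b + \<theta>) ^ n / fact n) = g n" for n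
  proof -
    have "(b + \<theta>) ^ n \<noteq> 0" using assms by simp
    then show ?thesis unfolding g_def by (rule weighted_square_diff)
  qed
  have "g sums (risk b e' \<theta> - risk b e \<theta>)"
    using sums_diff[OF risk_sums[OF assms(1,2,4)] risk_sums[OF assms(1-3)]] by (simp only: g)
  moreover have "g sums (\<Sum>n\<in>N. g n)"
    using \<open>finite N\<close> by (rule sums_finite) (simp add: g_def eq)
  ultimately show ?thesis by (simp add: sums_unique2 g_def sum_distrib_left)
qed

section \<open>A first-order criterion for inadmissibility\<close>

lemma eventually_is_estimator_perturb:
  assumes e: "is_estimator e" and N: "finite N" "\<And>n. n \<notin> N \<Longrightarrow> d n = 0"
    and pos: "\<And>n. n \<in> N \<Longrightarrow> e n > 0" and less: "\<And>n. d n > 0 \<Longrightarrow> e n < 1"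
  shows "\<forall>\<^sub>F t in at_right 0. is_estimator (\<lambda>n. e n + t * d n)"
proof -
  have range: "0 \<le> e n" "e n \<le> 1" for n using e by (auto simp: is_estimator_def)
  have "\<forall>\<^sub>F t in at_right 0. e n + t * d n \<in> {0..1}" if n: "n \<in> N" for n
  proof -
    have lim: "((\<lambda>t. e n + t * d n) \<longlongrightarrow> e n + 0 * d n) (at_right 0)"
      by (intro tendsto_intros)
    then have lower: "\<forall>\<^sub>F t in at_right 0. 0 < e n + t * d n"
      using pos[OF n] by (auto dest: order_tendstoD)
    have upper: "\<forall>\<^sub>F t in at_right 0. e n + t * d n \<le> 1"
    proof (cases "d n > 0")
      case True
      then have "\<forall>\<^sub>F t in at_right 0. e n + t * d n < 1"
        using lim less[of n] by (auto dest: order_tendstoD)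
      then show ?thesis by eventually_elim simp
    next
      case False
      show ?thesis using eventually_at_right_less[of 0]
      proof eventually_elim
        case (elim t)
        then have "t * d n \<le> 0" using False by (simp add: mult_le_0_iff)
        then show ?case using range(2)[of n] by linarith
      qed
    qed
    show ?thesis using lower upper by eventually_elim simp
  qed
  then have "\<forall>\<^sub>F t in at_right 0. \<forall>n\<in>N. e n + t * d n \<in> {0..1}"
    using N(1) by (simp add: eventually_ball_finite)
  then show ?thesis
  proof eventually_elim
    case (elim t)
    have "e n + t * d n \<in> {0..1}" for n
      using elim N(2)[of n] range[of n] by (cases "n \<in> N") auto
    then show ?case by (simp add: is_estimator_def)
  qed
qed

lemma quadratic_perturbation:
  fixes M W F :: real
  assumes "M \<noteq> 0" "W \<noteq> 0" "F \<noteq> 0"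
  shows "V * W * (((e + t * (c * F / (W * M)))\<^sup>2 - e\<^sup>2) * M
      - 2 * (e + t * (c * F / (W * M)) - e) * (W * M)) / F =
    t * (2 * (c * (e * V - V * W)) + t * (c\<^sup>2 * (F / (W * M)) * V))"
  using assms by (simp add: field_simps power2_eq_square)

text \<open>
  The reduction to the first-order part, in the variable \<open>v = b / (b + \<theta>)\<close>: the perturbation is
  a small multiple of \<open>c n * fact n / b ^ n\<close>, its support lies in \<open>{..k}\<close>, and the first-order part has been
  halved and multiplied by \<open>v ^ k\<close>.
\<close>

lemma inadmissible_if_first_order_neg:
  assumes b: "b > 0" and e: "is_estimator e" and N: "N \<subseteq> {..k}"
    and zero: "\<And>n. n \<notin> N \<Longrightarrow> c n = 0"
    and pos: "\<And>n. n \<in> N \<Longrightarrow> e n > 0" and less: "\<And>n. c n > 0 \<Longrightarrow> e n < 1"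
    and first: "\<And>v. v \<in> {0..1} \<Longrightarrow> (\<Sum>n\<in>N. c n * (e n * v ^ (k - n) - v ^ k)) < 0"
  shows "inadmissible b e"
proof -
  define d where "d n = c n * fact n / b ^ n" for n
  define F where "F v = (\<Sum>n\<in>N. c n * (e n * v ^ (k - n) - v ^ k))" for v
  define Q where "Q v = (\<Sum>n\<in>N. (c n)\<^sup>2 * (fact n / b ^ n) * v ^ (k - n))" for v
  have fin: "finite N" using N finite_subset by blast
  have "\<forall>\<^sub>F t in at_right 0. \<forall>v\<in>{0..1}. 2 * F v + t * Q v < 0"
  proof (rule eventually_perturb_neg)
    show "2 * F v \<le> 0" "2 * F v = 0 \<Longrightarrow> Q v < 0" if "v \<in> {0..1}" for v
      using first[OF that] by (auto simp: F_def)
  qed (use b in \<open>auto simp: F_def Q_def intro!: continuous_intros\<close>)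
  moreover have "\<forall>\<^sub>F t in at_right 0. is_estimator (\<lambda>n. e n + t * d n)"
  proof (rule eventually_is_estimator_perturb[OF e fin])
    show "d n = 0" if "n \<notin> N" for n using zero[OF that] by (simp add: d_def)
    show "e n < 1" if "d n > 0" for n
      using that b less[of n] by (simp add: d_def zero_less_divide_iff zero_less_mult_iff)
  qed (rule pos)
  ultimately have "\<forall>\<^sub>F t in at_right 0. (\<forall>v\<in>{0..1}. 2 * F v + t * Q v < 0)
      \<and> is_estimator (\<lambda>n. e n + t * d n) \<and> t > (0::real)"
    using eventually_at_right_less[of "0::real"] by eventually_elim simp
  then obtain t where t: "t > 0" and neg: "\<And>v. v \<in> {0..1} \<Longrightarrow> 2 * F v + t * Q v < 0"
    and e': "is_estimator (\<lambda>n. e n + t * d n)"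
    using eventually_happens'[OF trivial_limit_at_right_real] by blast
  have "risk b (\<lambda>n. e n + t * d n) \<theta> < risk b e \<theta>" if \<theta>: "\<theta> \<ge> 0" for \<theta>
  proof -
    define \<mu> v where "\<mu> = b + \<theta>" and "v = b / \<mu>"
    have \<mu>: "\<mu> > 0" and v: "v > 0" "v \<in> {0..1}" and bv: "b = v * \<mu>"
      using b \<theta> by (auto simp: \<mu>_def v_def)
    have sum_eq: "v ^ k * (((e n + t * d n)\<^sup>2 - (e n)\<^sup>2) * \<mu> ^ n - 2 * (e n + t * d n - e n) * b ^ n)
        / fact n = t * (2 * (c n * (e n * v ^ (k - n) - v ^ k))
          + t * ((c n)\<^sup>2 * (fact n / b ^ n) * v ^ (k - n)))" if "n \<in> N" for n
    proof -
      have k: "v ^ k = v ^ (k - n) * v ^ n" using that N by (auto simp flip: power_add)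
      have bn: "b ^ n = v ^ n * \<mu> ^ n" by (simp add: bv power_mult_distrib)
      have nz: "v ^ n \<noteq> 0" "\<mu> ^ n \<noteq> 0" using \<mu> v by simp_all
      show ?thesis unfolding d_def k bn
        using nz by (intro quadratic_perturbation) simp_all
    qed
    have "v ^ k * (risk b (\<lambda>n. e n + t * d n) \<theta> - risk b e \<theta>) = exp (- \<mu>) *
        (\<Sum>n\<in>N. v ^ k * (((e n + t * d n)\<^sup>2 - (e n)\<^sup>2) * \<mu> ^ n - 2 * (e n + t * d n - e n) * b ^ n)
          / fact n)"
      by (subst risk_diff[OF b \<theta> e e' fin])
        (simp_all add: d_def zero \<mu>_def sum_distrib_left mult_ac)
    also have "\<dots> = exp (- \<mu>) * (t * (2 * F v + t * Q v))"
      by (simp only: sum_eq F_def Q_def sum_distrib_left sum.distrib distrib_left cong: sum.cong)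
    also have "\<dots> < 0"
      using neg[OF v(2)] t by (simp add: mult_pos_neg)
    finally show ?thesis using v(1) by (simp add: mult_less_0_iff not_less[symmetric])
  qed
  then show ?thesis using e e' unfolding inadmissible_def
    by (intro conjI exI[of _ "\<lambda>n. e n + t * d n"]) (auto intro: less_imp_le)
qed

section \<open>The maximum likelihood estimator\<close>

lemma mle_no_signal_prob_bounds:
  assumes "b > 0"
  shows mle_no_signal_prob_pos: "mle_no_signal_prob b n > 0"
    and mle_no_signal_prob_le_1: "mle_no_signal_prob b n \<le> 1"
    and mle_no_signal_prob_less_1: "b < real n \<Longrightarrow> mle_no_signal_prob b n < 1"
    and mle_no_signal_prob_eq_1: "real n \<le> b \<Longrightarrow> mle_no_signal_prob b n = 1"
proof -
  have m: "max b (real n) > 0" using assms by simp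
  show "mle_no_signal_prob b n > 0" "mle_no_signal_prob b n \<le> 1"
    using assms m by (auto simp: mle_no_signal_prob_eq intro!: power_mono)
  show "mle_no_signal_prob b n < 1" if "b < real n"
  proof -
    have "n > 0" using that assms by (cases n) auto
    then show ?thesis using that assms
      by (simp add: mle_no_signal_prob_eq max_def power_strict_mono)
  qed
  show "mle_no_signal_prob b n = 1" if "real n \<le> b"
    using that assms by (simp add: mle_no_signal_prob_eq max_def)
qed

theorem theorem1:
  fixes b :: real
  assumes "b \<ge> 1"
  shows "inadmissible b (mle_no_signal_prob b)"
proof -
  have b: "b > 0" using assms by simp
  let ?a = "mle_no_signal_prob b"
  obtain m :: nat where m: "b < real m" using reals_Archimedean2 by blast
  then have m2: "m \<ge> 2" using assms by linarith
  \<comment> \<open>Any \<open>r > 0\<close> with \<open>r * (1 - ?a (Suc m)) < 1 - ?a m\<close> would do.\<close>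
  define r where "r = 1 - ?a m"
  have r: "r > 0" using mle_no_signal_prob_less_1[OF b m] by (simp add: r_def)
  have a: "?a 1 = 1" "?a m > 0" "?a (Suc m) > 0"
    using mle_no_signal_prob_bounds[OF b] assms by auto
  \<comment> \<open>Half the first-order part, multiplied by \<open>v ^ Suc m\<close>, is \<open>f v + \<epsilon> * h v\<close>: \<open>f\<close> comes from the
    point \<open>1\<close> and \<open>h\<close> from \<open>m\<close> and \<open>Suc m\<close>.\<close>
  define f h :: "real \<Rightarrow> real"
    where "f v = v ^ Suc m - v ^ m"
      and "h v = (?a m * v - v ^ Suc m) - r * (?a (Suc m) - v ^ Suc m)" for v
  have "\<forall>\<^sub>F \<epsilon> in at_right 0. \<forall>v\<in>{0..1}. f v + \<epsilon> * h v < 0"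
  proof (rule eventually_perturb_neg)
    fix v :: real assume v: "v \<in> {0..1}"
    have f: "f v = - (v ^ m * (1 - v))" by (simp add: f_def algebra_simps)
    show "f v \<le> 0" using v by (simp add: f)
    assume "f v = 0"
    then have "v = 0 \<or> v = 1" by (auto simp: f)
    then show "h v < 0"
    proof
      assume "v = 0"
      then show ?thesis using r a by (simp add: h_def)
    next
      assume "v = 1"
      then have "h v = - (r * ?a (Suc m))" by (simp add: h_def r_def algebra_simps)
      then show ?thesis using r a by simp
    qed
  qed (auto simp: f_def h_def intro!: continuous_intros)
  then have "\<forall>\<^sub>F \<epsilon> in at_right 0. (\<forall>v\<in>{0..1}. f v + \<epsilon> * h v < 0) \<and> \<epsilon> > (0::real)"
    using eventually_at_right_less[of "0::real"] by eventually_elim simp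
  then obtain \<epsilon> where \<epsilon>: "\<epsilon> > 0" and neg: "\<And>v. v \<in> {0..1} \<Longrightarrow> f v + \<epsilon> * h v < 0"
    using eventually_happens'[OF trivial_limit_at_right_real] by blast
  define c where "c n = (if n = 1 then - 1 else if n = m then \<epsilon> else
    if n = Suc m then - (r * \<epsilon>) else 0)" for n
  show ?thesis
  proof (rule inadmissible_if_first_order_neg[where N = "{1, m, Suc m}" and k = "Suc m" and c = c])
    show "is_estimator ?a"
      using mle_no_signal_prob_bounds[OF b] by (auto simp: is_estimator_def less_imp_le)
    show "?a n < 1" if "c n > 0" for n
      using that \<epsilon> r m mle_no_signal_prob_less_1[OF b, of n]
      by (auto simp: c_def mult_less_0_iff split: if_splits)
    show "(\<Sum>n\<in>{1, m, Suc m}. c n * (?a n * v ^ (Suc m - n) - v ^ Suc m)) < 0"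
      if "v \<in> {0..1}" for v
    proof -
      have "(\<Sum>n\<in>{1, m, Suc m}. c n * (?a n * v ^ (Suc m - n) - v ^ Suc m)) = f v + \<epsilon> * h v"
        using m2 a(1) by (simp add: c_def f_def h_def algebra_simps)
      then show ?thesis using neg[OF that] by simp
    qed
  qed (use b m2 mle_no_signal_prob_pos[OF b] in \<open>auto simp: c_def\<close>)
qed

end
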